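(* Let $\mathcal{V}$ be a primitive subspace of $\mathcal{J}_3(\mathbb{F}_2)$ with dimension $2$. Then $\mathcal{V}$ is equivalent to the space $$\left\{\begin{bmatrix}a&0&0\\0&a+b&0\\0&0&b\end{bmatrix}\mid (a,b)\in\mathbb{F}_2^2\right\}.$$
   Context: $\mathrm{M}_{n,p}(\mathbb{K})$ is the space of $n\times p$ matrices over a field $\mathbb{K}$, and $\mathrm{M}_n(\mathbb{K})=\mathrm{M}_{n,n}(\mathbb{K})$. The upper rank $\operatorname{urk}(\mathcal{V})$ of a linear subspace $\mathcal{V}$ of $\mathrm{M}_{n,p}(\mathbb{K})$ is the maximal rank of a matrix in $\mathcal{V}$. Two linear subspaces $\mathcal{V}_1,\mathcal{V}_2$ of $\mathrm{M}_{n,p}(\mathbb{K})$ are equivalent when $\mathcal{V}_2=P\mathcal{V}_1Q$ for some $P\in\mathrm{GL}_n(\mathbb{K})$, $Q\in\mathrm{GL}_p(\mathbb{K})$. A linear subspace $\mathcal{V}$ of $\mathrm{M}_{n,p}(\mathbb{K})$ with upper rank $r$ is called primitive when: (i) no non-zero vector of $\mathbb{K}^p$ belongs to the kernel of every matrix of $\mathcal{V}$; (ii) the span of the ranges of all the matrices of $\mathcal{V}$ is $\mathbb{K}^n$; (iii) $\mathcal{V}$ is not equivalent to a space $\mathcal{T}$ of matrices of the form $M=\begin{bmatrix} H(M) & [?]_{n\times 1}\end{bmatrix}$ (so $H(M)\in\mathrm{M}_{n,p-1}(\mathbb{K})$) where $\operatorname{urk}H(\mathcal{T})\leq r-1$;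 (iv) $\mathcal{V}$ is not equivalent to a space $\mathcal{T}$ of matrices of the form $M=\begin{bmatrix} H(M)\\ [?]_{1\times p}\end{bmatrix}$ (so $H(M)\in\mathrm{M}_{n-1,p}(\mathbb{K})$) where $\operatorname{urk}H(\mathcal{T})\leq r-1$. $\mathcal{J}_3(\mathbb{F}_2)$ is the space of all upper-triangular $3\times 3$ matrices over $\mathbb{F}_2$ with trace zero. *)

theory Defs
  imports "Jordan_Normal_Form.DL_Rank" "HOL-Library.Z2"
begin

text \<open>
  The matrices are those of \<^typ>\<open>'a mat\<close>, with \<open>M\<^sub>n\<^sub>,\<^sub>p(K)\<close> rendered as
  \<^term>\<open>carrier_mat n p :: 'a mat set\<close>; row and column indices start at 0.
\<close>

definition mat_subspace :: "nat \<Rightarrow> nat \<Rightarrow> 'a::field mat set \<Rightarrow> bool" where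
  "mat_subspace n p \<V> \<longleftrightarrow> VectorSpace.subspace class_ring \<V> (module_mat TYPE('a) n p)"

definition mat_subspace_dim :: "nat \<Rightarrow> nat \<Rightarrow> 'a::field mat set \<Rightarrow> nat" where
  "mat_subspace_dim n p \<V> =
     vectorspace.dim class_ring (module_mat TYPE('a) n p\<lparr>carrier := \<V>\<rparr>)"

text \<open>The parameter \<open>n\<close> is the number of rows. The set of ranks is finite, as the rank of a
  matrix is at most its number of columns.\<close>

definition urk :: "nat \<Rightarrow> 'a::field mat set \<Rightarrow> nat" where
  "urk n \<V> = Max (vec_space.rank n ` \<V>)"

definition equivalent_spaces :: "nat \<Rightarrow> nat \<Rightarrow> 'a::field mat set \<Rightarrow> 'a mat set \<Rightarrow> bool" where
  "equivalent_spaces n p \<V>\<^sub>1 \<V>\<^sub>2 \<longleftrightarrow>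
     (\<exists>P\<in>carrier_mat n n. \<exists>Q\<in>carrier_mat p p. invertible_mat P \<and> invertible_mat Q \<and>
        \<V>\<^sub>2 = (\<lambda>M. P * M * Q) ` \<V>\<^sub>1)"

text \<open>The block \<open>H(M)\<close> of \<open>M = [H(M) | ?]\<close>, respectively of \<open>M = [H(M) / ?]\<close>.\<close>

definition drop_last_col :: "'a mat \<Rightarrow> 'a mat" where
  "drop_last_col M = mat (dim_row M) (dim_col M - 1) (\<lambda>(i, j). M $$ (i, j))"

definition drop_last_row :: "'a mat \<Rightarrow> 'a mat" where
  "drop_last_row M = mat (dim_row M - 1) (dim_col M) (\<lambda>(i, j). M $$ (i, j))"

text \<open>The bound \<open>r - 1\<close> is taken in the integers: for \<open>r = 0\<close> it must be \<open>- 1\<close>, which no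
  upper rank satisfies, and not the truncated difference.\<close>

definition primitive :: "nat \<Rightarrow> nat \<Rightarrow> 'a::field mat set \<Rightarrow> bool" where
  "primitive n p \<V> \<longleftrightarrow>
     mat_subspace n p \<V> \<and>
     \<not> (\<exists>x\<in>carrier_vec p. x \<noteq> 0\<^sub>v p \<and> (\<forall>M\<in>\<V>. M *\<^sub>v x = 0\<^sub>v n)) \<and>
     LinearCombinations.module.span class_ring (module_vec TYPE('a) n)
       (\<Union>M\<in>\<V>. (\<lambda>x. M *\<^sub>v x) ` carrier_vec p) = carrier_vec n \<and>
     \<not> (\<exists>\<T>. equivalent_spaces n p \<V> \<T> \<and>
            int (urk n (drop_last_col ` \<T>)) \<le> int (urk n \<V>) - 1) \<and>
     \<not> (\<exists>\<T>. equivalent_spaces n p \<V> \<T> \<and>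
            int (urk (n - 1) (drop_last_row ` \<T>)) \<le> int (urk n \<V>) - 1)"

text \<open>The field with two elements is the type \<^typ>\<open>bit\<close>; \<^term>\<open>sum_list (diag_mat M)\<close> is the
  trace of \<open>M\<close>.\<close>

definition J3 :: "bit mat set" where
  "J3 = {M \<in> carrier_mat 3 3. upper_triangular M \<and> sum_list (diag_mat M) = 0}"

end

theory Submission
  imports Defs
begin

text \<open>
  A matrix of \<^const>\<open>J3\<close> has diagonal \<open>(a, a + b, b)\<close>, so its diagonal is either zero or one
  of \<open>(1, 1, 0)\<close>, \<open>(0, 1, 1)\<close>, \<open>(1, 0, 1)\<close>, and each of these three is the sum of the other two.
  In a primitive space, none of the three diagonal positions vanishes identically.
  If the first one did, the first basis vector would be a common kernel vector; if the last one
  did, all the ranges would lie in the plane of vectors with last entry zero. If the middle one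
  did, then every matrix would have its nonzero entries in the first row and the last column.
  Deleting the first row would then leave a single nonzero column, hence rank at most 1, while
  the space contains a matrix with diagonal \<open>(1, 0, 1)\<close>, whose rank is at least 2; but in a
  primitive space no deletion of a row, after any change of basis, lowers the upper rank.

  Each of the three nonzero diagonals vanishes at exactly one position, so at least two of them
  occur, and by addition all of them do (\<open>primitive_J3_generators\<close>). As a space of
  dimension 2 over the field with two elements has at most 4 elements, the diagonal determines
  the matrix, and the entries above the diagonal are linear functions of \<open>(a, b)\<close>.
  These functions can be cancelled by row and column operations: in the entry at position
  \<open>(0, 1)\<close>, for instance, adding a multiple of the second row to the first contributes a multiple
  of \<open>a + b\<close>, adding a multiple of the first column to the second contributes a multiple of \<open>a\<close>,
  and \<open>a\<close> and \<open>a + b\<close> span all linear forms in \<open>(a, b)\<close>. The other two positions are alike, since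
  any two of the three diagonal forms are independent (\<open>upper3_pencil_diagonalize\<close>).
\<close>

text \<open>Written as bit operations, sums and products of bits would escape the ring
  normalisation used below.\<close>

declare add_bit_eq_xor [simp del] mult_bit_eq_and [simp del]

section \<open>Vector spaces over a finite field\<close>

text \<open>Linear combinations over a basis of \<open>d\<close> elements are indexed by the
  \<open>|K|\<^sup>d\<close> families of coefficients, and they exhaust the space.\<close>

lemma (in vectorspace) card_carrier_le_power_dim:
  assumes "finite (carrier K)" "finite (carrier V)"
  shows "card (carrier V) \<le> card (carrier K) ^ dim"
proof -
  have "span (carrier V) = carrier V"
    using span_is_subset2[of "carrier V"] in_own_span[of "carrier V"] by blast
  then have "fin_dim"
    unfolding fin_dim_def using assms(2) by blast
  then obtain B where B: "finite B" "basis B"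
    using finite_basis_exists by blast
  then have BV: "B \<subseteq> carrier V" and span: "span B = carrier V"
    by (auto simp: basis_def)
  have "carrier V \<subseteq> (\<lambda>c. lincomb c B) ` (B \<rightarrow>\<^sub>E carrier K)"
  proof
    fix v assume "v \<in> carrier V"
    then obtain c where c: "c \<in> B \<rightarrow> carrier K" "v = lincomb c B"
      using span finite_span[OF B(1) BV] by blast
    have "lincomb (restrict c B) B = lincomb c B"
      by (rule lincomb_cong) (use B BV c in auto)
    then show "v \<in> (\<lambda>c. lincomb c B) ` (B \<rightarrow>\<^sub>E carrier K)"
      using c by (intro image_eqI[of _ _ "restrict c B"]) auto
  qed
  moreover have fin: "finite (B \<rightarrow>\<^sub>E carrier K)"
    using B(1) assms(1) by (intro finite_PiE) auto
  ultimately have "card (carrier V) \<le> card (B \<rightarrow>\<^sub>E carrier K)"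
    using card_mono card_image_le order_trans finite_imageI by meson
  also have "\<dots> = card (carrier K) ^ dim"
    using B by (simp add: card_PiE dim_basis)
  finally show ?thesis .
qed

lemma mat_subspace_card_le:
  fixes \<V> :: "'a::field mat set"
  assumes "mat_subspace n p \<V>" "finite (UNIV :: 'a set)" "finite \<V>"
  shows "card \<V> \<le> card (UNIV :: 'a set) ^ mat_subspace_dim n p \<V>"
proof -
  interpret W: vectorspace class_ring "module_mat TYPE('a) n p\<lparr>carrier := \<V>\<rparr>"
    using vectorspace.subspace_is_vs[OF matrix_vs] assms(1)
    by (simp add: mat_subspace_def)
  show ?thesis
    using W.card_carrier_le_power_dim assms by (simp add: mat_subspace_dim_def)
qed

lemma mat_subspace_closed:
  assumes "mat_subspace n p \<V>"
  shows mat_subspace_add: "A \<in> \<V> \<Longrightarrow> B \<in> \<V> \<Longrightarrow> A + B \<in> \<V>"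
    and mat_subspace_zero: "0\<^sub>m n p \<in> \<V>"
proof -
  interpret submodule class_ring \<V> "module_mat TYPE('a) n p"
    using assms by (simp add: mat_subspace_def subspace_def)
  show "A \<in> \<V> \<Longrightarrow> B \<in> \<V> \<Longrightarrow> A + B \<in> \<V>" "0\<^sub>m n p \<in> \<V>"
    using m_closed zero_closed by (simp_all add: module_mat_simps)
qed

lemma UNIV_bit: "(UNIV :: bit set) = {0, 1}"
  by (auto intro: bit.exhaust)

lemma card_UNIV_bit: "card (UNIV :: bit set) = 2"
  and finite_UNIV_bit: "finite (UNIV :: bit set)"
  by (simp_all add: UNIV_bit)

section \<open>Upper triangular 3 by 3 matrices\<close>

definition upper3 :: "'a \<Rightarrow> 'a \<Rightarrow> 'a \<Rightarrow> 'a \<Rightarrow> 'a \<Rightarrow> 'a \<Rightarrow> 'a::zero mat" where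
  "upper3 a b c x y z = mat_of_rows_list 3 [[a, x, y], [0, b, z], [0, 0, c]]"

lemma less_3_iff: "i < (3::nat) \<longleftrightarrow> i = 0 \<or> i = 1 \<or> i = 2"
  by auto

lemma mat3_eqI:
  assumes "M \<in> carrier_mat 3 3" "N \<in> carrier_mat 3 3"
    and "M $$ (0,0) = N $$ (0,0)" "M $$ (0,1) = N $$ (0,1)" "M $$ (0,2) = N $$ (0,2)"
    and "M $$ (1,0) = N $$ (1,0)" "M $$ (1,1) = N $$ (1,1)" "M $$ (1,2) = N $$ (1,2)"
    and "M $$ (2,0) = N $$ (2,0)" "M $$ (2,1) = N $$ (2,1)" "M $$ (2,2) = N $$ (2,2)"
  shows "M = N"
proof (rule eq_matI)
  fix i j assume "i < dim_row N" "j < dim_col N"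
  then have "i = 0 \<or> i = 1 \<or> i = 2" "j = 0 \<or> j = 1 \<or> j = 2"
    using assms(2) by (simp_all add: less_3_iff)
  then show "M $$ (i, j) = N $$ (i, j)"
    using assms(3-) by (elim disjE) simp_all
qed (use assms in auto)

lemma upper3_dim [simp]:
  "dim_row (upper3 a b c x y z) = 3" "dim_col (upper3 a b c x y z) = 3"
  by (simp_all add: upper3_def mat_of_rows_list_def)

lemma upper3_carrier [simp]: "upper3 a b c x y z \<in> carrier_mat 3 3"
  by (rule carrier_matI) simp_all

lemma upper3_index [simp]:
  "upper3 a b c x y z $$ (0, 0) = a" "upper3 a b c x y z $$ (0, Suc 0) = x"
  "upper3 a b c x y z $$ (0, 2) = y" "upper3 a b c x y z $$ (Suc 0, 0) = 0"
  "upper3 a b c x y z $$ (Suc 0, Suc 0) = b" "upper3 a b c x y z $$ (Suc 0, 2) = z"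
  "upper3 a b c x y z $$ (2, 0) = 0" "upper3 a b c x y z $$ (2, Suc 0) = 0"
  "upper3 a b c x y z $$ (2, 2) = c"
  by (simp_all add: upper3_def mat_of_rows_list_def)

lemma upper3_cases:
  assumes "M \<in> carrier_mat 3 3" "upper_triangular M"
  obtains a b c x y z where "M = upper3 a b c x y z"
proof (rule that)
  show "M = upper3 (M $$ (0,0)) (M $$ (1,1)) (M $$ (2,2)) (M $$ (0,1)) (M $$ (0,2)) (M $$ (1,2))"
    by (rule mat3_eqI) (use assms in \<open>simp_all add: upper_triangularD\<close>)
qed

lemma upt_3: "[0..<3] = [0, 1, 2]"
  by (simp add: eval_nat_numeral)

lemma sum_3: "sum f {0..<3::nat} = f 0 + f 1 + f 2"
  by (simp add: eval_nat_numeral)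

lemma upper3_mult:
  fixes a :: "'a::comm_ring_1"
  shows "upper3 a b c x y z * upper3 a' b' c' x' y' z' =
    upper3 (a * a') (b * b') (c * c') (a * x' + x * b') (a * y' + x * z' + y * c') (b * z' + z * c')"
  by (rule eq_matI) (auto simp: less_3_iff scalar_prod_def sum_3)

lemma upper3_add:
  fixes a :: "'a::comm_ring_1"
  shows "upper3 a b c x y z + upper3 a' b' c' x' y' z' =
    upper3 (a + a') (b + b') (c + c') (x + x') (y + y') (z + z')"
  by (rule eq_matI) (auto simp: less_3_iff)

lemma upper3_one: "upper3 1 1 1 0 0 0 = 1\<^sub>m 3"
  by (rule eq_matI) (auto simp: less_3_iff)

lemma upper3_zero: "upper3 0 0 0 0 0 0 = 0\<^sub>m 3 3"
  by (rule eq_matI) (auto simp: less_3_iff)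

lemma invertible_unitriangular3:
  fixes x :: "'a::comm_ring_1"
  shows "invertible_mat (upper3 1 1 1 x y z)"
  unfolding invertible_mat_def inverts_mat_def square_mat.simps
  by (intro conjI exI[of _ "upper3 1 1 1 (- x) (x * z - y) (- z)"])
    (simp_all add: upper3_mult algebra_simps flip: upper3_one)

text \<open>In characteristic 2, trace zero says that the middle diagonal entry is the sum of the
  outer two.\<close>

lemma J3_cases:
  assumes "M \<in> J3"
  obtains a b x y z where "M = upper3 a (a + b) b x y z"
proof -
  have "M \<in> carrier_mat 3 3" "upper_triangular M"
    using assms by (auto simp: J3_def)
  then obtain a b c x y z where M: "M = upper3 a b c x y z"
    by (rule upper3_cases)
  then have "a + (b + c) = 0"
    using assms by (auto simp: J3_def diag_mat_def upt_3)
  then have "b = a + c"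
    by (cases a; cases b; cases c) auto
  then show thesis
    using that[of a c x y z] M by simp
qed

lemma finite_J3: "finite J3"
proof -
  have "J3 \<subseteq> (\<lambda>(a, b, x, y, z). upper3 a (a + b) b x y z) ` UNIV"
  proof
    fix M assume "M \<in> J3"
    then obtain a b x y z where "M = upper3 a (a + b) b x y z"
      by (rule J3_cases)
    then show "M \<in> (\<lambda>(a, b, x, y, z). upper3 a (a + b) b x y z) ` UNIV"
      by (intro image_eqI[of _ _ "(a, b, x, y, z)"]) auto
  qed
  moreover have "finite (UNIV :: (bit \<times> bit \<times> bit \<times> bit \<times> bit) set)"
    by (simp add: finite_prod finite_UNIV_bit)
  ultimately show ?thesis
    using finite_surj by blast
qed

section \<open>What primitivity forces on the diagonals\<close>

lemma equivalent_spacesI: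
  assumes "P \<in> carrier_mat n n" "Q \<in> carrier_mat p p" "invertible_mat P" "invertible_mat Q"
  shows "equivalent_spaces n p \<V> ((\<lambda>M. P * M * Q) ` \<V>)"
  unfolding equivalent_spaces_def by (rule bexI[OF bexI[OF _ assms(2)] assms(1)]) (simp add: assms(3,4))

lemma primitive_subspace: "primitive n p \<V> \<Longrightarrow> mat_subspace n p \<V>"
  by (simp add: primitive_def)

text \<open>If no matrix had this property, the first column of each would be zero, and the first
  unit vector would be killed by the whole space.\<close>

lemma primitive_J3_diag0:
  assumes "primitive 3 3 \<V>" "\<V> \<subseteq> J3"
  shows "\<exists>M\<in>\<V>. M $$ (0,0) = 1"
proof (rule ccontr)
  assume "\<not> ?thesis"
  then have *: "M $$ (0,0) = 0" if "M \<in> \<V>" for M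
    using that by auto
  have "M *\<^sub>v unit_vec 3 0 = 0\<^sub>v 3" if "M \<in> \<V>" for M
  proof -
    have "M \<in> J3" using that assms by auto
    then obtain a b x y z where M: "M = upper3 a (a + b) b x y z"
      by (rule J3_cases)
    show ?thesis
      using *[OF that] unfolding M
      by (intro eq_vecI) (auto simp: less_3_iff scalar_prod_def sum_3)
  qed
  moreover have "unit_vec 3 0 \<noteq> (0\<^sub>v 3 :: bit vec)"
    by (simp add: unit_vec_nonzero)
  ultimately show False
    using assms(1) unfolding primitive_def by (meson unit_vec_carrier)
qed

text \<open>If no matrix had this property, the last row of each would be zero, and the ranges would
  lie in a plane.\<close>

lemma primitive_J3_diag2:
  assumes "primitive 3 3 \<V>" "\<V> \<subseteq> J3"
  shows "\<exists>M\<in>\<V>. M $$ (2,2) = 1"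
proof (rule ccontr)
  assume "\<not> ?thesis"
  then have *: "M $$ (2,2) = 0" if "M \<in> \<V>" for M
    using that by auto
  interpret vec_space "TYPE(bit)" 3 .
  let ?R = "\<Union>M\<in>\<V>. (\<lambda>x. M *\<^sub>v x) ` carrier_vec 3"
  let ?H = "{v \<in> carrier_vec 3. v $ 2 = (0::bit)}"
  have "?R \<subseteq> ?H"
  proof clarify
    fix M and u :: "bit vec"
    assume MV: "M \<in> \<V>" and u: "u \<in> carrier_vec 3"
    then have "M \<in> J3" using assms by auto
    then obtain a b x y z where M: "M = upper3 a (a + b) b x y z"
      by (rule J3_cases)
    show "M *\<^sub>v u \<in> carrier_vec 3 \<and> (M *\<^sub>v u) $ 2 = 0"
      using *[OF MV] u unfolding M
      by (auto simp: scalar_prod_def sum_3 intro!: mult_mat_vec_carrier[of _ 3 3])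
  qed
  moreover have "submodule class_ring ?H V"
    by (rule submodule.intro) (auto simp: module_vec_simps vec_module)
  ultimately have "span ?R \<subseteq> ?H"
    using span_is_subset by blast
  moreover have "unit_vec 3 2 \<in> span ?R"
    using assms(1) by (simp add: primitive_def)
  ultimately show False by auto
qed

lemma urk_le:
  assumes "\<W> \<noteq> {}" "\<And>M. M \<in> \<W> \<Longrightarrow> vec_space.rank n M \<le> k"
  shows "urk n \<W> \<le> k"
proof -
  have "vec_space.rank n ` \<W> \<subseteq> {..k}" using assms by auto
  then have "finite (vec_space.rank n ` \<W>)" using finite_subset by blast
  then show ?thesis using assms by (simp add: urk_def)
qed

lemma rank_le_urk:
  fixes \<W> :: "'a::field mat set"
  assumes "\<W> \<subseteq> carrier_mat n p" "M \<in> \<W>"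
  shows "vec_space.rank n M \<le> urk n \<W>"
proof -
  have "vec_space.rank n ` \<W> \<subseteq> {..p}"
    using assms(1) by (auto intro!: vec_space.rank_le_nc)
  then have "finite (vec_space.rank n ` \<W>)" using finite_subset by blast
  then show ?thesis using assms(2) by (simp add: urk_def)
qed

text \<open>Putting a 1 in the middle of the diagonal makes the matrix invertible, and this
  changes the rank by at most 1.\<close>

lemma rank_upper3_ge_2:
  fixes x :: "'a::field"
  shows "2 \<le> vec_space.rank 3 (upper3 1 0 1 x y z)"
proof -
  interpret vec_space "TYPE('a)" 3 .
  let ?A = "upper3 1 0 1 x y z" and ?E = "upper3 0 1 0 0 0 (0::'a)"
  have "det (?A + ?E) = 1"
    by (subst det_upper_triangular[of _ 3])
      (auto simp: upper3_add upper_triangular_def less_3_iff less_2_cases_iff diag_mat_def upt_3)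
  then have "rank (?A + ?E) = 3"
    by (intro low_rank_det_zero) auto
  moreover have "rank ?E \<le> 1"
    by (rule rank_le_1_product_entries[of _ 3 "\<lambda>i. of_bool (i = 1)" "\<lambda>j. of_bool (j = 1)"])
      (auto simp: less_3_iff)
  ultimately show ?thesis
    using rank_subadditive[of ?A 3 ?E] by simp
qed

text \<open>If no matrix had this property, each would have the form
  \<open>[[a, x, y], [0, 0, z], [0, 0, a]]\<close>. Without the first row, only the last column
  is left, so the rank drops to at most 1, whereas the matrix with \<open>a = 1\<close> provided by
  \<open>primitive_J3_diag0\<close> has rank at least 2. Primitivity forbids that deleting a row
  lowers the upper rank.\<close>

lemma primitive_J3_diag1:
  assumes "primitive 3 3 \<V>" "\<V> \<subseteq> J3"
  shows "\<exists>M\<in>\<V>. M $$ (1,1) = 1"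
proof (rule ccontr)
  assume "\<not> ?thesis"
  then have *: "M $$ (1,1) = 0" if "M \<in> \<V>" for M
    using that by auto
  have cases: "\<exists>a x y z. M = upper3 a 0 a x y z" if "M \<in> \<V>" for M
  proof -
    have "M \<in> J3" using that assms by auto
    then obtain a b x y z where M: "M = upper3 a (a + b) b x y z"
      by (rule J3_cases)
    with *[OF that] have "a = b" by (cases a; cases b) auto
    with M * that show ?thesis by auto
  qed
  obtain M where M: "M \<in> \<V>" "M $$ (0,0) = 1"
    using primitive_J3_diag0[OF assms] by blast
  then obtain x y z where "M = upper3 1 0 1 x y z"
    using cases by fastforce
  then have "2 \<le> vec_space.rank 3 M"
    using rank_upper3_ge_2 by blast
  also have "\<dots> \<le> urk 3 \<V>"
    by (rule rank_le_urk[of _ _ 3]) (use M assms in \<open>auto simp: J3_def\<close>)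
  finally have urkV: "2 \<le> urk 3 \<V>" .
  \<comment> \<open>Primitivity speaks of deleting the last row, so the first row is moved there.\<close>
  define S :: "bit mat" where "S = mat_of_rows_list 3 [[0,0,1],[0,1,0],[1,0,0]]"
  have S: "S \<in> carrier_mat 3 3"
    by (rule carrier_matI) (simp_all add: S_def mat_of_rows_list_def)
  have "S * S = 1\<^sub>m 3"
    by (rule eq_matI) (auto simp: S_def mat_of_rows_list_def less_3_iff scalar_prod_def sum_3)
  then have "invertible_mat S"
    using S unfolding invertible_mat_def inverts_mat_def by auto
  moreover have "invertible_mat (1\<^sub>m 3 :: bit mat)"
    using invertible_unitriangular3[of 0 0 0] by (simp add: upper3_one)
  ultimately have eqv: "equivalent_spaces 3 3 \<V> ((\<lambda>M. S * M * 1\<^sub>m 3) ` \<V>)" (is "equivalent_spaces _ _ _ ?T")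
    using S by (intro equivalent_spacesI) auto
  have "vec_space.rank 2 N \<le> 1" if "N \<in> drop_last_row ` ?T" for N
  proof -
    obtain M where "M \<in> \<V>" and N: "N = drop_last_row (S * M * 1\<^sub>m 3)"
      using \<open>N \<in> _\<close> by auto
    then obtain a x y z where M: "M = upper3 a 0 a x y z"
      using cases by blast
    show ?thesis
      by (rule vec_space.rank_le_1_product_entries
            [of _ _ 3 "\<lambda>i. if i = 0 then a else z" "\<lambda>j. of_bool (j = 2)"])
        (auto simp: N M drop_last_row_def S_def mat_of_rows_list_def less_3_iff less_2_cases_iff
          scalar_prod_def sum_3)
  qed
  then have "urk 2 (drop_last_row ` ?T) \<le> 1"
    by (intro urk_le) (use M in auto)
  with urkV have "int (urk (3 - 1) (drop_last_row ` ?T)) \<le> int (urk 3 \<V>) - 1"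
    by simp
  with eqv assms(1) show False
    unfolding primitive_def by blast
qed

text \<open>The matrices with a nonzero first, middle and last diagonal entry given above cannot all
  have the same diagonal, as each diagonal has a zero entry. Two with different diagonals
  have a sum with the third one, so the two diagonals wanted here both occur.\<close>

lemma primitive_J3_generators:
  assumes "primitive 3 3 \<V>" "\<V> \<subseteq> J3"
  obtains p q r s t u where "upper3 1 1 0 p q r \<in> \<V>" "upper3 0 1 1 s t u \<in> \<V>"
proof -
  have add: "A + B \<in> \<V>" if "A \<in> \<V>" "B \<in> \<V>" for A B
    using mat_subspace_add primitive_subspace assms(1) that by blast
  have form: "\<exists>a b x y z. M = upper3 a (a + b) b x y z" if "M \<in> \<V>" for M
    using J3_cases assms(2) that by (meson subsetD)
  obtain b x y z where A: "upper3 1 (1 + b) b x y z \<in> \<V>"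
    using primitive_J3_diag0[OF assms] form by force
  obtain a x' y' z' where B: "upper3 a (a + 1) 1 x' y' z' \<in> \<V>"
    using primitive_J3_diag2[OF assms] form by force
  obtain c x'' y'' z'' where C: "upper3 c 1 (1 + c) x'' y'' z'' \<in> \<V>"
  proof -
    obtain M where "M \<in> \<V>" "M $$ (1,1) = 1"
      using primitive_J3_diag1[OF assms] by blast
    with form[of M] obtain c d x y z where M: "M = upper3 c (c + d) d x y z" and cd: "c + d = 1"
      by auto
    have "d = 1 + c" using cd by (cases c; cases d) auto
    with M cd \<open>M \<in> \<V>\<close> show thesis using that by simp
  qed
  show thesis
    using A B C add[OF A B] add[OF A C] add[OF B C] that
    by (cases a; cases b; cases c) (auto simp: upper3_add)
qed

section \<open>Reduction to the diagonal space\<close>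

lemma bit_add_self: "x + x = 0" for x :: bit
  by (cases x) simp_all

lemma bit_add_left_self: "x + (x + y) = y" for x y :: bit
  by (simp add: bit_add_self flip: add.assoc)

text \<open>The multipliers solve the equations for the entries above the diagonal: at \<open>(0, 1)\<close>,
  \<open>a p + b s = s (a + b) + (p + s) a\<close>; at \<open>(1, 2)\<close>, \<open>a r + b u = (r + u) b + r (a + b)\<close>. At
  \<open>(0, 2)\<close>, the forms \<open>a\<close> and \<open>b\<close> appear with coefficients \<open>q + p r\<close> and \<open>t + s u\<close>, where the
  products come from the operations used at the other two positions.\<close>

lemma upper3_pencil_diagonalize:
  fixes a b :: bit
  shows "upper3 1 1 1 s (t + s * u) (r + u) *
      upper3 a (a + b) b (a * p + b * s) (a * q + b * t) (a * r + b * u) *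
      upper3 1 1 1 (p + s) (p * r + q) r = upper3 a (a + b) b 0 0 0"
  by (simp add: upper3_mult algebra_simps bit_add_self bit_add_left_self)

theorem proposition4p1:
  fixes \<V> :: "bit mat set"
  assumes "primitive 3 3 \<V>"
    and "\<V> \<subseteq> J3"
    and "mat_subspace_dim 3 3 \<V> = 2"
  shows "equivalent_spaces 3 3 \<V>
           {mat_of_rows_list 3 [[a, 0, 0], [0, a + b, 0], [0, 0, b]] | a b. True}"
proof -
  obtain p q r s t u
    where A: "upper3 1 1 0 p q r \<in> \<V>" and B: "upper3 0 1 1 s t u \<in> \<V>"
    using primitive_J3_generators[OF assms(1,2)] by blast
  have sub: "mat_subspace 3 3 \<V>"
    using primitive_subspace assms(1) .
  \<comment> \<open>The linear combination of the two generators with coefficients \<open>a\<close> and \<open>b\<close>. As the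
    diagonal is injective in \<open>(a, b)\<close>, these are four matrices, and \<open>\<V>\<close> has no more.\<close>
  define M where "M = (\<lambda>(a, b).
    upper3 a (a + b) b (a * p + b * s) (a * q + b * t) (a * r + b * u))"
  have inj: "inj M"
  proof (rule injI, clarify)
    fix a b a' b' assume "M (a, b) = M (a', b')"
    then have "M (a, b) $$ (0,0) = M (a', b') $$ (0,0)" "M (a, b) $$ (2,2) = M (a', b') $$ (2,2)"
      by simp_all
    then show "a = a' \<and> b = b'" by (simp add: M_def)
  qed
  have "M (a, b) \<in> \<V>" for a b
    using A B mat_subspace_add[OF sub A B] mat_subspace_zero[OF sub]
    by (cases a; cases b) (simp_all add: M_def upper3_add upper3_zero)
  then have range: "range M \<subseteq> \<V>" by auto
  have "card \<V> \<le> 4"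
    using mat_subspace_card_le[OF sub] finite_subset[OF assms(2) finite_J3] assms(3)
    by (simp add: card_UNIV_bit finite_UNIV_bit)
  also have "4 = card (range M)"
  proof -
    have "card (UNIV :: (bit \<times> bit) set) = 4"
      by (simp add: card_UNIV_bit card_cartesian_product flip: UNIV_Times_UNIV)
    then show ?thesis using card_image[OF inj] by simp
  qed
  finally have V: "\<V> = range M"
    using card_seteq[OF finite_subset[OF assms(2) finite_J3] range] by simp
  let ?P = "upper3 1 1 1 s (t + s * u) (r + u)" and ?Q = "upper3 1 1 1 (p + s) (p * r + q) r"
  have "(\<lambda>N. ?P * N * ?Q) ` \<V> = range (\<lambda>(a, b). upper3 a (a + b) b 0 0 0)"
    unfolding V image_image
    by (rule image_cong) (auto simp: M_def upper3_pencil_diagonalize)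
  also have "\<dots> = {mat_of_rows_list 3 [[a, 0, 0], [0, a + b, 0], [0, 0, b]] | a b. True}"
    by (simp add: image_def upper3_def)
  finally show ?thesis
    using equivalent_spacesI[of ?P 3 ?Q 3 \<V>] by (simp add: invertible_unitriangular3)
qed

end
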